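(* Let $T=\mathbb{Z}$ or $\mathbb{R}$ and $\alpha\in(0,2)$. Every S$\alpha$S harmonizable process $\int_{\widehat T}e^{itx}N_\alpha(dx)$, $t\in T$ (complex-valued case), and every S$\alpha$S trivial process $\int_{\{1\}}N_\alpha(dx)+n(t)\int_{\{2\}}N_\alpha(dx)$, $t\in T$ (real-valued case), where $N_\alpha$ has a finite control measure, can be represented in distribution as $$\int_Z\int_{[0,q(z))}b_1(z)^{[v+t]_{q(z)}}\,g(z,\{v+t\}_{q(z)})\,M_\alpha(dz,dv),\qquad t\in T,$$ for some standard Lebesgue space $(Z,\mathcal Z,\sigma)$ and measurable functions $q(z)\in T_+$ a.e. $\sigma(dz)$, $g\in L^\alpha(Z\times[0,q(\cdot)),\sigma(dz)\lambda(dv))$ and $b_1(z)\in\{-1,1\}$ (real-valued case) or $b_1(z)\in\{w\in\mathbb{C}:|w|=1\}$ (complex-valued case), where $M_\alpha$ has control measure $\sigma(dz)\lambda(dv)$.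
   Context: $\lambda$ is counting measure on $\mathbb{Z}$ if $T=\mathbb{Z}$, Lebesgue measure if $T=\mathbb{R}$; $\widehat T=\mathbb{R}$ if $T=\mathbb{R}$, $\widehat T=[0,2\pi)$ if $T=\mathbb{Z}$; $n(t)=0$ if $T=\mathbb{R}$, $n(t)=(-1)^t$ if $T=\mathbb{Z}$; $T_+=(0,\infty)$ if $T=\mathbb{R}$, $T_+=\{2,3,\dots\}$ if $T=\mathbb{Z}$. For $a>0$, $x\in\mathbb{R}$: $[x]_a=\max\{n\in\mathbb{Z}:na\le x\}$, $\{x\}_a=x-a[x]_a$. $Z\times[0,q(\cdot))=\{(z,v):z\in Z,0\le v<q(z)\}$. A standard Lebesgue space is a standard Borel space with a $\sigma$-finite measure. Random measures are real-valued S$\alpha$S, or complex-valued rotationally invariant S$\alpha$S; $\int_Sf_t\,dM_\alpha$ with control measure $\nu$ has finite-dimensional distributions determined by $E\exp\{i\sum_k\theta_kX(t_k)\}=\exp\{-\int_S|\sum_k\theta_kf_{t_k}|^\alpha d\nu\}$, $\theta_k\in\mathbb{R}$ (real case), or $E\exp\{i\sum_k\Re(\overline{\theta_k}X(t_k))\}=\exp\{-c_0\int_S|\sum_k\overline{\theta_k}f_{t_k}|^\alpha d\nu\}$, $\theta_k\in\mathbb{C}$, $c_0=(2\pi)^{-1}\int_0^{2\pi}|\cos\phi|^\alpha d\phi$ (complex case). *)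

theory Defs
  imports "HOL-Probability.Probability"
begin

text \<open>The time set \<open>T\<close> is a set of reals: \<open>T = \<int>\<close> (the integers embedded in the reals)
  or \<open>T = UNIV\<close>. The definitions depending on \<open>T\<close> below are only meant for these two sets.\<close>

definition time_measure :: "real set \<Rightarrow> real measure" where
  "time_measure T = (if T = \<int> then count_space \<int> else lborel)"

definition time_dual :: "real set \<Rightarrow> real set" where
  "time_dual T = (if T = \<int> then {0..<2 * pi} else UNIV)"

definition time_periods :: "real set \<Rightarrow> real set" where
  "time_periods T = (if T = \<int> then {x \<in> \<int>. 2 \<le> x} else {0<..})"

definition sign_fun :: "real set \<Rightarrow> real \<Rightarrow> real" where
  "sign_fun T t = (if T = \<int> then (- 1) powi \<lfloor>t\<rfloor> else 0)"

definition int_part :: "real \<Rightarrow> real \<Rightarrow> int" where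
  "int_part a x = (GREATEST n::int. of_int n * a \<le> x)"

definition frac_part :: "real \<Rightarrow> real \<Rightarrow> real" where
  "frac_part a x = x - a * of_int (int_part a x)"

definition standard_borel_space :: "'a measure \<Rightarrow> bool" where
  "standard_borel_space S \<longleftrightarrow>
     (\<exists>\<tau>. topspace \<tau> = space S \<and> completely_metrizable_space \<tau> \<and> second_countable \<tau>
        \<and> sets S = sigma_sets (space S) {U. openin \<tau> U})"

definition standard_lebesgue_space :: "'a measure \<Rightarrow> bool" where
  "standard_lebesgue_space S \<longleftrightarrow> standard_borel_space S \<and> sigma_finite_measure S"

definition in_L :: "real \<Rightarrow> 's measure \<Rightarrow> ('s \<Rightarrow> 'b::{real_normed_vector}) \<Rightarrow> bool" where
  "in_L \<alpha> \<nu> f \<longleftrightarrow> f \<in> borel_measurable \<nu> \<and> integrable \<nu> (\<lambda>s. norm (f s) powr \<alpha>)"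

text \<open>\<open>is_real_stable_integral T \<alpha> P X \<nu> f\<close> says that the process \<open>X\<close> on the probability space \<open>P\<close>
  is in distribution the process of integrals of \<open>f t\<close>, \<open>t \<in> T\<close>, with respect to a real-valued
  symmetric \<open>\<alpha>\<close>-stable random measure with control measure \<open>\<nu>\<close>. The finite-dimensional
  distributions of the latter are given through their characteristic functions. The complex
  version refers to rotationally invariant random measures.\<close>

definition is_real_stable_integral ::
  "real set \<Rightarrow> real \<Rightarrow> 'w measure \<Rightarrow> (real \<Rightarrow> 'w \<Rightarrow> real) \<Rightarrow> 's measure \<Rightarrow> (real \<Rightarrow> 's \<Rightarrow> real) \<Rightarrow> bool"
where
  "is_real_stable_integral T \<alpha> P X \<nu> f \<longleftrightarrow>
     prob_space P \<and> (\<forall>t\<in>T. X t \<in> borel_measurable P) \<and> (\<forall>t\<in>T. in_L \<alpha> \<nu> (f t)) \<and>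
     (\<forall>(n::nat) (t :: nat \<Rightarrow> real) (\<theta> :: nat \<Rightarrow> real). (\<forall>k<n. t k \<in> T) \<longrightarrow>
        (CLINT w|P. iexp (\<Sum>k<n. \<theta> k * X (t k) w)) =
        of_real (exp (- (LINT s|\<nu>. \<bar>\<Sum>k<n. \<theta> k * f (t k) s\<bar> powr \<alpha>))))"

definition isotropic_const :: "real \<Rightarrow> real" where
  "isotropic_const \<alpha> = (LINT \<phi>:{0..2 * pi}|lborel. \<bar>cos \<phi>\<bar> powr \<alpha>) / (2 * pi)"

definition is_complex_stable_integral ::
  "real set \<Rightarrow> real \<Rightarrow> 'w measure \<Rightarrow> (real \<Rightarrow> 'w \<Rightarrow> complex) \<Rightarrow> 's measure \<Rightarrow> (real \<Rightarrow> 's \<Rightarrow> complex) \<Rightarrow> bool"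
where
  "is_complex_stable_integral T \<alpha> P X \<nu> f \<longleftrightarrow>
     prob_space P \<and> (\<forall>t\<in>T. X t \<in> borel_measurable P) \<and> (\<forall>t\<in>T. in_L \<alpha> \<nu> (f t)) \<and>
     (\<forall>(n::nat) (t :: nat \<Rightarrow> real) (\<theta> :: nat \<Rightarrow> complex). (\<forall>k<n. t k \<in> T) \<longrightarrow>
        (CLINT w|P. iexp (\<Sum>k<n. Re (cnj (\<theta> k) * X (t k) w))) =
        of_real (exp (- (isotropic_const \<alpha> *
          (LINT s|\<nu>. cmod (\<Sum>k<n. cnj (\<theta> k) * f (t k) s) powr \<alpha>)))))"

definition harmonizable_process :: "real set \<Rightarrow> real \<Rightarrow> 'w measure \<Rightarrow> (real \<Rightarrow> 'w \<Rightarrow> complex) \<Rightarrow> bool" where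
  "harmonizable_process T \<alpha> P X \<longleftrightarrow>
     (\<exists>\<nu>::real measure. sets \<nu> = sets (restrict_space borel (time_dual T)) \<and> finite_measure \<nu>
        \<and> is_complex_stable_integral T \<alpha> P X \<nu> (\<lambda>t x. iexp (t * x)))"

text \<open>The sum of the two integrals over \<open>{1}\<close> and \<open>{2}\<close> is written as one integral over
  \<open>{1, 2}\<close>.\<close>

definition trivial_process :: "real set \<Rightarrow> real \<Rightarrow> 'w measure \<Rightarrow> (real \<Rightarrow> 'w \<Rightarrow> real) \<Rightarrow> bool" where
  "trivial_process T \<alpha> P X \<longleftrightarrow>
     (\<exists>\<nu>::nat measure. sets \<nu> = Pow {1, 2} \<and> finite_measure \<nu>
        \<and> is_real_stable_integral T \<alpha> P X \<nu>
            (\<lambda>t x. indicator {1} x + sign_fun T t * indicator {2} x))"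

definition cyclic_measure ::
  "real set \<Rightarrow> 'z measure \<Rightarrow> ('z \<Rightarrow> real) \<Rightarrow> ('z \<times> real) measure" where
  "cyclic_measure T \<sigma> q =
     restrict_space (\<sigma> \<Otimes>\<^sub>M time_measure T) {(z, v). 0 \<le> v \<and> v < q z}"

definition cyclic_kernel ::
  "('z \<Rightarrow> real) \<Rightarrow> ('z \<Rightarrow> 'b::real_normed_field) \<Rightarrow> ('z \<times> real \<Rightarrow> 'b) \<Rightarrow> real \<Rightarrow> 'z \<times> real \<Rightarrow> 'b" where
  "cyclic_kernel q b g t =
     (\<lambda>(z, v). b z powi int_part (q z) (v + t) * g (z, frac_part (q z) (v + t)))"

text \<open>In the two predicates below the standard Lebesgue space is carried by the reals. This is no
  restriction, as every standard Borel space is isomorphic to a Borel subset of the reals.\<close>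

definition real_cyclic_representation ::
  "real set \<Rightarrow> real \<Rightarrow> 'w measure \<Rightarrow> (real \<Rightarrow> 'w \<Rightarrow> real) \<Rightarrow> bool" where
  "real_cyclic_representation T \<alpha> P X \<longleftrightarrow>
     (\<exists>(\<sigma>::real measure) q g b.
        standard_lebesgue_space \<sigma>
        \<and> q \<in> borel_measurable \<sigma> \<and> (AE z in \<sigma>. q z \<in> time_periods T)
        \<and> in_L \<alpha> (cyclic_measure T \<sigma> q) g
        \<and> b \<in> borel_measurable \<sigma> \<and> (\<forall>z\<in>space \<sigma>. b z \<in> {- 1, 1})
        \<and> is_real_stable_integral T \<alpha> P X (cyclic_measure T \<sigma> q) (cyclic_kernel q b g))"

definition complex_cyclic_representation ::
  "real set \<Rightarrow> real \<Rightarrow> 'w measure \<Rightarrow> (real \<Rightarrow> 'w \<Rightarrow> complex) \<Rightarrow> bool" where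
  "complex_cyclic_representation T \<alpha> P X \<longleftrightarrow>
     (\<exists>(\<sigma>::real measure) q g b.
        standard_lebesgue_space \<sigma>
        \<and> q \<in> borel_measurable \<sigma> \<and> (AE z in \<sigma>. q z \<in> time_periods T)
        \<and> in_L \<alpha> (cyclic_measure T \<sigma> q) g
        \<and> b \<in> borel_measurable \<sigma> \<and> (\<forall>z\<in>space \<sigma>. b z \<in> {w. cmod w = 1})
        \<and> is_complex_stable_integral T \<alpha> P X (cyclic_measure T \<sigma> q) (cyclic_kernel q b g))"

end

theory Submission
  imports Defs
begin

text \<open>With the constant period \<open>q = 2\<close>, every fibre \<open>[0, 2)\<close> has \<open>\<lambda>\<close>-mass \<open>2\<close> for
  \<open>T = \<int>\<close> as well as for \<open>T = \<real>\<close>. A harmonizable process is represented by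
  \<open>g(z,v) = 2\<^bsup>-1/\<alpha>\<^esup> e\<^bsup>ivz\<^esup>\<close> and \<open>b(z) = e\<^bsup>2iz\<^esup>\<close>: the cyclic kernel at time \<open>t\<close> is then
  \<open>2\<^bsup>-1/\<alpha>\<^esup> e\<^bsup>ivz\<^esup> e\<^bsup>itz\<^esup>\<close>, in which the unimodular factor \<open>e\<^bsup>ivz\<^esup>\<close> does not affect the modulus of linear
  combinations and the constant cancels the mass of the fibre. A trivial process is treated in the same
  way with \<open>b = 1\<close> and the factor \<open>(-1)\<^bsup>v\<^esup>\<close> over the atom \<open>2\<close>.\<close>

section \<open>Standard Lebesgue spaces, the time measure and the fibre
  \<open>[0, 2)\<close>\<close>

lemma standard_lebesgue_space_borel:
  fixes \<sigma> :: "'a::polish_space measure"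
  assumes "sets \<sigma> = sets borel" "finite_measure \<sigma>"
  shows "standard_lebesgue_space \<sigma>"
proof -
  have sp: "space \<sigma> = UNIV"
    using sets_eq_imp_space_eq[OF assms(1)] by simp
  interpret finite_measure \<sigma> by fact
  \<comment> \<open>The topology of the type itself is the Polish topology required. Its countable
    basis, given by unions, is recast in the pointwise form of
    \<open>second_countable\<close>.\<close>
  obtain B :: "'a set set" where "countable B" "topological_basis B"
    using ex_countable_basis by blast
  then have "second_countable (euclidean :: 'a topology)"
    unfolding second_countable_def topological_basis_def
    by (intro exI[of _ B]) (simp, blast)
  then show ?thesis
    unfolding standard_lebesgue_space_def standard_borel_space_def
    using assms(1) sp sigma_finite_measure_axioms
    by (intro conjI exI[of _ euclidean])
       (auto simp: borel_def completely_metrizable_space_euclidean)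
qed

text \<open>This gives the product formula for rectangles. Any \<open>T\<close> other than
  \<open>\<int>\<close> carries Lebesgue measure by definition.\<close>

lemma sigma_finite_time_measure: "sigma_finite_measure (time_measure T)"
proof (cases "T = \<int>")
  case True
  have "countable (\<int> :: real set)"
    by (simp add: Ints_def)
  then show ?thesis
    by (simp add: True time_measure_def sigma_finite_measure_count_space_countable)
next
  case False
  then show ?thesis
    by (simp add: time_measure_def lborel.sigma_finite_measure_axioms)
qed

lemma space_time_measure: "T = \<int> \<or> T = UNIV \<Longrightarrow> space (time_measure T) = T"
  by (auto simp: time_measure_def)

text \<open>Counting measure sees the two integers 0 and 1, Lebesgue measure an interval of length
  2. The period 2 is also the least one in \<open>time_periods \<int>\<close>.\<close>

lemma emeasure_time_measure_fibre:
  "emeasure (time_measure T) {v \<in> space (time_measure T). 0 \<le> v \<and> v < 2} = 2"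
proof (cases "T = \<int>")
  case True
  have "{v \<in> \<int>. 0 \<le> v \<and> v < 2} = {0, 1 :: real}"
    by (auto elim!: Ints_cases)
  then show ?thesis
    by (simp add: True time_measure_def emeasure_count_space)
next
  case False
  have "{v :: real. 0 \<le> v \<and> v < 2} = {0..<2}"
    by auto
  then show ?thesis
    by (simp add: False time_measure_def)
qed

lemma sets_time_measure_fibre [measurable]:
  "{v \<in> space (time_measure T). 0 \<le> v \<and> v < 2} \<in> sets (time_measure T)"
  by (auto simp: time_measure_def)

text \<open>With a constant period the region below the graph of \<open>q\<close> is a rectangle.
  The intersection with the space is the form in which measures of restricted spaces are
  computed.\<close>

lemma sets_fibre:
  "{(z, v). 0 \<le> v \<and> v < 2} \<inter> space (\<sigma> \<Otimes>\<^sub>M time_measure T) \<in> sets (\<sigma> \<Otimes>\<^sub>M time_measure T)"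
proof -
  have "{(z, v). 0 \<le> v \<and> v < 2} \<inter> space (\<sigma> \<Otimes>\<^sub>M time_measure T)
      = space \<sigma> \<times> {v \<in> space (time_measure T). 0 \<le> v \<and> v < 2}"
    by (auto simp: space_pair_measure)
  then show ?thesis
    by simp
qed

section \<open>The cyclic measure of constant period 2 and kernels on it\<close>

lemma space_cyclic_measure:
  "space (cyclic_measure T \<sigma> q)
    = {(z, v). z \<in> space \<sigma> \<and> v \<in> space (time_measure T) \<and> 0 \<le> v \<and> v < q z}"
  by (auto simp: cyclic_measure_def space_restrict_space space_pair_measure)

lemma measurable_cyclic_measureI:
  "f \<in> measurable (\<sigma> \<Otimes>\<^sub>M time_measure T) N \<Longrightarrow> f \<in> measurable (cyclic_measure T \<sigma> q) N"
  unfolding cyclic_measure_def by (rule measurable_restrict_space1)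

text \<open>Every fibre has mass 2, so the part above a set \<open>A\<close> is a rectangle of
  measure twice that of \<open>A\<close>.\<close>

lemma distr_cyclic_measure_fst:
  "distr (cyclic_measure T \<sigma> (\<lambda>_. 2)) \<sigma> fst = density \<sigma> (\<lambda>_. 2)"
proof (rule measure_eqI)
  fix A
  assume "A \<in> sets (distr (cyclic_measure T \<sigma> (\<lambda>_. 2)) \<sigma> fst)"
  then have A: "A \<in> sets \<sigma>"
    by simp
  interpret sigma_finite_measure "time_measure T"
    by (rule sigma_finite_time_measure)
  let ?F = "{v \<in> space (time_measure T). 0 \<le> v \<and> v < 2}"
  have eq: "fst -` A \<inter> space (cyclic_measure T \<sigma> (\<lambda>_. 2)) = A \<times> ?F"
    using sets.sets_into_space[OF A]
    by (auto simp: space_cyclic_measure)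
  have "emeasure (distr (cyclic_measure T \<sigma> (\<lambda>_. 2)) \<sigma> fst) A
      = emeasure (cyclic_measure T \<sigma> (\<lambda>_. 2)) (A \<times> ?F)"
    using A by (subst emeasure_distr) (auto simp: eq intro!: measurable_cyclic_measureI)
  also have "\<dots> = emeasure (\<sigma> \<Otimes>\<^sub>M time_measure T) (A \<times> ?F)"
    unfolding cyclic_measure_def by (rule emeasure_restrict_space) (auto simp: sets_fibre)
  also have "\<dots> = emeasure \<sigma> A * 2"
    using A by (simp add: emeasure_pair_measure_Times emeasure_time_measure_fibre)
  also have "\<dots> = emeasure (density \<sigma> (\<lambda>_. 2)) A"
    using A by (simp add: emeasure_density nn_integral_cmult_indicator mult.commute[of _ 2])
  finally show "emeasure (distr (cyclic_measure T \<sigma> (\<lambda>_. 2)) \<sigma> fst) A = \<dots>" .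
qed simp

lemma
  fixes F :: "'z \<Rightarrow> real"
  assumes [measurable]: "F \<in> borel_measurable \<sigma>"
  shows integrable_cyclic_measure_fst:
      "integrable (cyclic_measure T \<sigma> (\<lambda>_. 2)) (\<lambda>p. F (fst p)) \<longleftrightarrow> integrable \<sigma> F" (is ?A)
    and integral_cyclic_measure_fst:
      "(LINT p|cyclic_measure T \<sigma> (\<lambda>_. 2). F (fst p)) = 2 * (LINT z|\<sigma>. F z)" (is ?B)
proof -
  let ?C = "cyclic_measure T \<sigma> (\<lambda>_. 2)"
  have fst: "fst \<in> measurable ?C \<sigma>"
    by (rule measurable_cyclic_measureI) simp
  \<comment> \<open>The rules for integrals against a density expect a real function under
    \<open>ennreal\<close>.\<close>
  have dens: "density \<sigma> (\<lambda>_. 2) = density \<sigma> (\<lambda>_. ennreal 2)"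
    by simp
  have "integrable ?C (\<lambda>p. F (fst p)) \<longleftrightarrow> integrable (distr ?C \<sigma> fst) F"
    by (rule integrable_distr_eq[symmetric]) (auto simp: fst)
  also have "\<dots> \<longleftrightarrow> integrable \<sigma> F"
    unfolding distr_cyclic_measure_fst dens by (subst integrable_density) auto
  finally show ?A .
  have "(LINT p|?C. F (fst p)) = integral\<^sup>L (distr ?C \<sigma> fst) F"
    by (rule integral_distr[symmetric]) (auto simp: fst)
  also have "\<dots> = 2 * (LINT z|\<sigma>. F z)"
    unfolding distr_cyclic_measure_fst dens by (subst integral_density) auto
  finally show ?B .
qed

text \<open>Condition \<open>twist\<close> says that a cyclic shift by \<open>t\<close>, with
  \<open>b\<close> recording the completed turns, turns \<open>u * f 0\<close> into
  \<open>u * f t\<close>. The factor \<open>u\<close> is common to all times and has norm 1, so it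
  leaves the norms of linear combinations unchanged. The type class covers the real and the complex
  case at once.\<close>

lemma
  fixes f :: "real \<Rightarrow> 'z \<Rightarrow> 'b::{real_normed_field, second_countable_topology}"
  assumes T: "T = \<int> \<or> T = UNIV" and \<alpha>: "0 < \<alpha>"
    and f: "\<And>t. t \<in> T \<Longrightarrow> in_L \<alpha> \<sigma> (f t)"
    and u: "u \<in> borel_measurable (\<sigma> \<Otimes>\<^sub>M time_measure T)"
    and norm_u: "\<And>p. norm (u p) = 1"
    and twist: "\<And>z v t. z \<in> space \<sigma> \<Longrightarrow> v \<in> T \<Longrightarrow> t \<in> T \<Longrightarrow>
      b z powi int_part 2 (v + t) * (u (z, frac_part 2 (v + t)) * f 0 z) = u (z, v) * f t z"
  defines "g \<equiv> \<lambda>(z, v). of_real (2 powr (- 1 / \<alpha>)) * (u (z, v) * f 0 z)"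
  shows in_L_twisted: "in_L \<alpha> (cyclic_measure T \<sigma> (\<lambda>_. 2)) g" (is ?A)
    and in_L_cyclic_kernel_twisted:
      "\<And>t. t \<in> T \<Longrightarrow> in_L \<alpha> (cyclic_measure T \<sigma> (\<lambda>_. 2)) (cyclic_kernel (\<lambda>_. 2) b g t)" (is "PROP ?B")
    and integral_cyclic_kernel_twisted:
      "\<And>a t n. \<forall>k<n. t k \<in> T \<Longrightarrow>
        (LINT p|cyclic_measure T \<sigma> (\<lambda>_. 2).
          norm (\<Sum>k<n::nat. a k * cyclic_kernel (\<lambda>_. 2) b g (t k) p) powr \<alpha>) =
        (LINT z|\<sigma>. norm (\<Sum>k<n. a k * f (t k) z) powr \<alpha>)" (is "PROP ?C")
proof -
  let ?M = "cyclic_measure T \<sigma> (\<lambda>_. 2)"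
  \<comment> \<open>\<open>c powr \<alpha>\<close> is to be 1/2, the reciprocal of the fibre
    mass.\<close>
  define c :: real where "c = 2 powr (- 1 / \<alpha>)"
  have "- 1 / \<alpha> * \<alpha> = - 1"
    using \<alpha> by simp
  then have c: "c > 0" "c powr \<alpha> = 1 / 2"
    unfolding c_def powr_powr by (simp_all add: powr_minus_divide)
  have f_meas: "f t \<in> borel_measurable \<sigma>" if "t \<in> T" for t
    using f[OF that] by (simp add: in_L_def)
  have zero: "0 \<in> T"
    using T by auto
  have norm_scaled: "norm (of_real c * (u p * x)) powr \<alpha> = norm x powr \<alpha> / 2" for p x
    using c by (simp add: norm_mult norm_u powr_mult)
  \<comment> \<open>The case \<open>t = 0\<close> yields \<open>g\<close>, the general case the
    cyclic kernel at time \<open>t\<close>.\<close>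
  have in_L_scaled: "in_L \<alpha> ?M (\<lambda>p. of_real c * (u p * f t (fst p)))" if t: "t \<in> T" for t
  proof -
    note [measurable] = u f_meas[OF t]
    have "(\<lambda>p. of_real c * (u p * f t (fst p))) \<in> borel_measurable ?M"
      by (rule measurable_cyclic_measureI) simp
    moreover have "integrable ?M (\<lambda>p. norm (f t (fst p)) powr \<alpha> / 2)"
      using f[OF t] by (intro integrable_divide)
        (simp add: integrable_cyclic_measure_fst[where F = "\<lambda>z. norm (f t z) powr \<alpha>"] in_L_def)
    ultimately show ?thesis
      unfolding in_L_def norm_scaled by blast
  qed
  \<comment> \<open>\<open>twist\<close> is available only for \<open>v\<close> in \<open>T\<close>,
    so the kernel identity below holds only on the space of \<open>?M\<close>; membership in
    \<open>in_L\<close> depends on these values alone.\<close>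
  have in_L_cong: "in_L \<alpha> ?M h"
    if "in_L \<alpha> ?M k" "\<And>p. p \<in> space ?M \<Longrightarrow> h p = k p" for h k :: "'z \<times> real \<Rightarrow> 'b"
    using that(1) unfolding in_L_def
    by (simp add: that(2) cong: measurable_cong Bochner_Integration.integrable_cong)
  have kernel: "cyclic_kernel (\<lambda>_. 2) b g t p = of_real c * (u p * f t (fst p))"
    if "t \<in> T" "p \<in> space ?M" for t p
  proof -
    obtain z v where p: "p = (z, v)" by fastforce
    with that(2) space_time_measure[OF T] have "z \<in> space \<sigma>" "v \<in> T"
      by (auto simp: space_cyclic_measure)
    from twist[OF this that(1)] show ?thesis
      by (simp add: p cyclic_kernel_def g_def c_def mult.left_commute)
  qed
  show ?A
    by (rule in_L_cong[OF in_L_scaled[OF zero]]) (auto simp: g_def c_def)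
  show "in_L \<alpha> ?M (cyclic_kernel (\<lambda>_. 2) b g t)" if "t \<in> T" for t
    by (rule in_L_cong[OF in_L_scaled[OF that]]) (rule kernel[OF that])
  show "(LINT p|?M. norm (\<Sum>k<n. a k * cyclic_kernel (\<lambda>_. 2) b g (t k) p) powr \<alpha>)
      = (LINT z|\<sigma>. norm (\<Sum>k<n. a k * f (t k) z) powr \<alpha>)"
    if t: "\<forall>k<n. t k \<in> T" for a t and n :: nat
  proof -
    let ?S = "\<lambda>z. \<Sum>k<n. a k * f (t k) z"
    have [measurable]: "?S \<in> borel_measurable \<sigma>"
      using t f_meas by (intro borel_measurable_sum borel_measurable_times) auto
    have "(\<Sum>k<n. a k * cyclic_kernel (\<lambda>_. 2) b g (t k) p)
        = of_real c * (u p * ?S (fst p))" if "p \<in> space ?M" for p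
      unfolding sum_distrib_left
      by (rule sum.cong) (use t that in \<open>auto simp: kernel mult.left_commute\<close>)
    then have "(LINT p|?M. norm (\<Sum>k<n. a k * cyclic_kernel (\<lambda>_. 2) b g (t k) p) powr \<alpha>)
        = (LINT p|?M. norm (?S (fst p)) powr \<alpha> / 2)"
      by (intro Bochner_Integration.integral_cong refl) (simp only: norm_scaled)
    also have "\<dots> = (LINT z|\<sigma>. norm (?S z) powr \<alpha>)"
      by (simp add: integral_cyclic_measure_fst[where F = "\<lambda>z. norm (?S z) powr \<alpha>"])
    finally show ?thesis .
  qed
qed

section \<open>Transport to the real line and the two classes of processes\<close>

lemma in_L_distr:
  fixes f :: "'z \<Rightarrow> 'b::real_normed_vector"
  assumes "h \<in> measurable \<nu> N" "f \<in> borel_measurable N" "in_L \<alpha> \<nu> (\<lambda>x. f (h x))"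
  shows "in_L \<alpha> (distr \<nu> N h) f"
  using assms by (auto simp: in_L_def integrable_distr_eq)

lemma harmonizable_imp_cyclic:
  assumes T: "T = \<int> \<or> T = UNIV" and \<alpha>: "0 < \<alpha>" and X: "harmonizable_process T \<alpha> P X"
  shows "complex_cyclic_representation T \<alpha> P X"
proof -
  define f :: "real \<Rightarrow> real \<Rightarrow> complex" where "f t x = iexp (t * x)" for t x
  obtain \<nu> :: "real measure"
    where sets_\<nu>: "sets \<nu> = sets (restrict_space borel (time_dual T))" and "finite_measure \<nu>"
      and Xf: "is_complex_stable_integral T \<alpha> P X \<nu> f"
    using X unfolding harmonizable_process_def f_def by blast
  interpret \<nu>: finite_measure \<nu> by fact
  have id: "(\<lambda>x. x) \<in> measurable \<nu> borel"
    by (subst measurable_cong_sets[OF sets_\<nu> refl]) (simp add: measurable_restrict_space1)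
  \<comment> \<open>The inclusion moves \<open>\<nu>\<close> from \<open>time_dual T\<close> to the
    whole Borel line, a Polish space, without changing the integrals.\<close>
  define \<sigma> where "\<sigma> = distr \<nu> borel (\<lambda>x. x)"
  have sets_\<sigma> [measurable_cong]: "sets \<sigma> = sets borel"
    by (simp add: \<sigma>_def)
  have [measurable]: "f t \<in> borel_measurable borel" for t
    unfolding f_def by measurable
  have f_\<sigma>: "in_L \<alpha> \<sigma> (f t)" if "t \<in> T" for t
    unfolding \<sigma>_def using Xf that id
    by (intro in_L_distr) (auto simp: is_complex_stable_integral_def)
  define u :: "real \<times> real \<Rightarrow> complex" where "u = (\<lambda>(z, v). iexp (z * v))"
  define b :: "real \<Rightarrow> complex" where "b z = iexp (2 * z)" for z
  define g where "g = (\<lambda>(z, v). of_real (2 powr (- 1 / \<alpha>)) * (u (z, v) * f 0 z))"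
  have id_time: "(\<lambda>x. x) \<in> borel_measurable (time_measure T)"
    by (simp add: time_measure_def)
  have u: "u \<in> borel_measurable (\<sigma> \<Otimes>\<^sub>M time_measure T)"
    supply id_time[measurable] unfolding u_def by measurable
  have norm_u: "norm (u p) = 1" for p
    by (simp add: u_def split_beta)
  have b_powi: "b z powi m = iexp (2 * z * of_int m)" for z m
    unfolding b_def exp_power_int by (simp add: mult_ac)
  \<comment> \<open>Write \<open>v + t = 2 * m + r\<close> with \<open>m\<close> the integer part
    and \<open>r\<close> the remainder, the relation defining \<open>frac_part\<close>. The phases
    \<open>2 * z * m\<close> and \<open>z * r\<close> add up to
    \<open>z * v + t * z\<close>.\<close>
  have twist: "b z powi int_part 2 (v + t) * (u (z, frac_part 2 (v + t)) * f 0 z) = u (z, v) * f t z"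
    for z v t
    unfolding b_powi u_def f_def frac_part_def
    by (simp add: exp_add[symmetric] algebra_simps)
  note rep = in_L_twisted in_L_cyclic_kernel_twisted integral_cyclic_kernel_twisted
  note rep = rep[OF T \<alpha> f_\<sigma> u norm_u twist, folded g_def]
  have int_\<sigma>: "(LINT z|\<sigma>. cmod (\<Sum>k<n. a k * f (t k) z) powr \<alpha>)
      = (LINT z|\<nu>. cmod (\<Sum>k<n. a k * f (t k) z) powr \<alpha>)" for a t and n :: nat
    unfolding \<sigma>_def by (rule integral_distr[OF id]) measurable
  \<comment> \<open>Both families of kernels give the same exponent for every linear combination, so
    the process \<open>X\<close> itself serves on the same space \<open>P\<close>.\<close>
  have "is_complex_stable_integral T \<alpha> P X (cyclic_measure T \<sigma> (\<lambda>_. 2)) (cyclic_kernel (\<lambda>_. 2) b g)"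
    using Xf by (simp add: is_complex_stable_integral_def rep int_\<sigma>)
  moreover have "standard_lebesgue_space \<sigma>"
    by (rule standard_lebesgue_space_borel) (auto simp: \<sigma>_def intro!: \<nu>.finite_measure_distr id)
  moreover have "b \<in> borel_measurable \<sigma>"
    unfolding b_def by measurable
  moreover have "\<forall>z. cmod (b z) = 1"
    by (simp add: b_def)
  moreover have "2 \<in> time_periods T"
    by (simp add: time_periods_def)
  ultimately show ?thesis
    unfolding complex_cyclic_representation_def
    by (intro exI[of _ \<sigma>] exI[of _ "\<lambda>_. 2"] exI[of _ g] exI[of _ b]) (simp add: rep)
qed

text \<open>Over the atom 1 the kernel is constant in time. Over the atom 2 with integer time, a
  shift by \<open>t\<close> multiplies \<open>(-1)^v\<close> by \<open>(-1)^t\<close>, and a full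
  turn changes nothing because the period is even; hence \<open>b = 1\<close> fits both
  atoms.\<close>

lemma trivial_imp_cyclic:
  assumes T: "T = \<int> \<or> T = UNIV" and \<alpha>: "0 < \<alpha>" and X: "trivial_process T \<alpha> P X"
  shows "real_cyclic_representation T \<alpha> P X"
proof -
  define f :: "real \<Rightarrow> real \<Rightarrow> real"
    where "f t x = indicator {1} x + sign_fun T t * indicator {2} x" for t x
  \<comment> \<open>The atoms 1 and 2 are natural numbers, while the representation is carried by
    the reals; \<open>f\<close> extends the kernel along \<open>real\<close>.\<close>
  have f_nat: "indicator {1} x + sign_fun T t * indicator {2} x = f t (real x)" for t and x :: nat
    by (simp add: f_def indicator_def)
  obtain \<nu> :: "nat measure"
    where sets_\<nu>: "sets \<nu> = Pow {1, 2}" and "finite_measure \<nu>"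
      and Xf: "is_real_stable_integral T \<alpha> P X \<nu> (\<lambda>t x. f t (real x))"
    using X unfolding trivial_process_def f_nat by blast
  interpret \<nu>: finite_measure \<nu> by fact
  have "sets \<nu> = sets (count_space {1, 2})"
    by (simp add: sets_\<nu>)
  then have id: "real \<in> measurable \<nu> borel"
    by (subst measurable_cong_sets[OF _ refl]) (assumption, simp)
  define \<sigma> where "\<sigma> = distr \<nu> borel real"
  have sets_\<sigma> [measurable_cong]: "sets \<sigma> = sets borel"
    by (simp add: \<sigma>_def)
  have [measurable]: "f t \<in> borel_measurable borel" for t
    unfolding f_def by measurable
  have f_\<sigma>: "in_L \<alpha> \<sigma> (f t)" if "t \<in> T" for t
    unfolding \<sigma>_def using Xf that id
    by (intro in_L_distr) (auto simp: is_real_stable_integral_def)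
  \<comment> \<open>Over the atom \<open>2\<close> the sign is only needed for \<open>T = \<int>\<close>; for \<open>T = \<real>\<close> the kernel vanishes there.\<close>
  define u :: "real \<times> real \<Rightarrow> real"
    where "u = (\<lambda>(z, v). if T = \<int> \<and> z = 2 then (- 1) powi \<lfloor>v\<rfloor> else 1)"
  define g where "g = (\<lambda>(z, v). of_real (2 powr (- 1 / \<alpha>)) * (u (z, v) * f 0 z))"
  have "(\<lambda>v. (- 1) powi \<lfloor>v\<rfloor> :: real) \<in> borel_measurable (time_measure T)" if "T = \<int>"
    by (simp add: that time_measure_def)
  then have u: "u \<in> borel_measurable (\<sigma> \<Otimes>\<^sub>M time_measure T)"
    unfolding u_def by (cases "T = \<int>") auto
  have norm_u: "norm (u p) = 1" for p
    by (simp add: u_def split_beta power_int_def norm_power)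
  \<comment> \<open>For integers the remainder is an integer that differs from \<open>v + t\<close>
    by an even number, so the parity is kept.\<close>
  have "(- 1) powi \<lfloor>frac_part 2 (v + t)\<rfloor> = ((- 1) powi \<lfloor>v\<rfloor> * (- 1) powi \<lfloor>t\<rfloor> :: real)"
    if "v \<in> \<int>" "t \<in> \<int>" for v t
  proof -
    obtain i j where ij: "v = of_int i" "t = of_int j"
      using \<open>v \<in> \<int>\<close> \<open>t \<in> \<int>\<close> by (auto elim!: Ints_cases)
    have "frac_part 2 (v + t) = of_int (i + j - 2 * int_part 2 (v + t))"
      by (simp add: frac_part_def ij)
    then have "\<lfloor>frac_part 2 (v + t)\<rfloor> = i + j - 2 * int_part 2 (v + t)"
      by linarith
    then show ?thesis
      by (simp add: ij power_int_diff power_int_add power_int_mult)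
  qed
  then have twist: "1 powi int_part 2 (v + t) * (u (z, frac_part 2 (v + t)) * f 0 z) = u (z, v) * f t z"
    if "v \<in> T" "t \<in> T" for z v t
    using T that by (auto simp: u_def f_def sign_fun_def indicator_def)
  note rep = in_L_twisted in_L_cyclic_kernel_twisted integral_cyclic_kernel_twisted
  note rep = rep[OF T \<alpha> f_\<sigma> u norm_u twist, folded g_def]
  have int_\<sigma>: "(LINT z|\<sigma>. norm (\<Sum>k<n. a k * f (t k) z) powr \<alpha>)
      = (LINT z|\<nu>. norm (\<Sum>k<n. a k * f (t k) (real z)) powr \<alpha>)" for a t and n :: nat
    unfolding \<sigma>_def by (rule integral_distr[OF id]) measurable
  have "is_real_stable_integral T \<alpha> P X (cyclic_measure T \<sigma> (\<lambda>_. 2)) (cyclic_kernel (\<lambda>_. 2) (\<lambda>_. 1) g)"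
    using Xf rep(3) int_\<sigma> by (simp add: is_real_stable_integral_def rep(2))
  moreover have "standard_lebesgue_space \<sigma>"
    by (rule standard_lebesgue_space_borel) (auto simp: \<sigma>_def intro!: \<nu>.finite_measure_distr id)
  moreover have "2 \<in> time_periods T"
    by (simp add: time_periods_def)
  ultimately show ?thesis
    unfolding real_cyclic_representation_def
    by (intro exI[of _ \<sigma>] exI[of _ "\<lambda>_. 2"] exI[of _ g] exI[of _ "\<lambda>_. 1"]) (simp add: rep)
qed

theorem lemma3p1:
  fixes T :: "real set" and \<alpha> :: real
  assumes "T = \<int> \<or> T = UNIV" and "0 < \<alpha>" and "\<alpha> < 2"
  shows "(\<forall>(P :: 'w measure) X. harmonizable_process T \<alpha> P X
             \<longrightarrow> complex_cyclic_representation T \<alpha> P X)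
       \<and> (\<forall>(P :: 'w measure) X. trivial_process T \<alpha> P X
             \<longrightarrow> real_cyclic_representation T \<alpha> P X)"
  by (intro conjI allI impI harmonizable_imp_cyclic[OF assms(1,2)] trivial_imp_cyclic[OF assms(1,2)])

end
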